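(* Let $n\ge 1$ and let $\mathrm{Ass}_n^{\rm II}(A_n)$ be any polytope whose normal fan is the fan with maximal cones $\mathbb{R}_{\ge 0}C$ generated by all clusters $C$ of type $A_n$. Then $\mathrm{Ass}_n^{\rm II}(A_n)$ has exactly $n$ pairs of parallel facets. These correspond to the pairs of roots $\{\alpha_i,-\alpha_i\}$ for $i=1,\dots,n$ (i.e. the two facets in a pair are the ones with normal vectors $\alpha_i$ and $-\alpha_i$), or equivalently, to the pairs of diagonals of the $(n+3)$-gon identified with $\alpha_i$ and $-\alpha_i$, for $i=1,\dots,n$.
   Context: The root system of type $A_n$ is $\Phi=\{e_i-e_j: 1\le i\ne j\le n+1\}$; the simple roots are $\Pi=\{\alpha_i=e_i-e_{i+1}: i=1,\dots,n\}$; the positive roots are $\Phi_{>0}=\{e_i-e_j: i<j\}$; the almost positive roots are $\Phi_{\ge -1}=\Phi_{>0}\cup(-\Pi)$. Identification of $\Phi_{\ge -1}$ with the diagonals of a convex $(n+3)$-gon $P_{n+3}$: label the vertices of $P_{n+3}$ by $1,\dots,n+3$ in cyclic order. The negative simple roots $-\alpha_1,\dots,-\alpha_n$ are identified, in this order, with the diagonals of a zigzag ("snake"): $-\alpha_{2i-1}$ with $\{i,n+3-i\}$ for $1\le i\le (n+1)/2$ and $-\alpha_{2i}$ with $\{i+1,n+3-i\}$ for $1\le i\le n/2$. Each positive root is of the form $\alpha_{ij}=\alpha_i+\alpha_{i+1}+\cdots+\alpha_j$ with $1\le i\le j\le n$, and is identified with the unique diagonal that crosses exactly the snake diagonals $-\alpha_i,-\alpha_{i+1},\dots,-\alpha_j$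 among the snake diagonals. Two almost positive roots are compatible if their diagonals do not cross (in the interior of the polygon). Clusters are the maximal sets of pairwise compatible almost positive roots. The cones $\mathbb{R}_{\ge 0}C$ over all clusters $C$ form a complete simplicial fan in $V=\{x\in\mathbb{R}^{n+1}: x_1+\cdots+x_{n+1}=0\}$, with rays spanned by the almost positive roots, and this fan is the normal fan of a simple $n$-dimensional polytope in $V$ (identify $V$ with its dual via the standard inner product). Thus the facets of $\mathrm{Ass}_n^{\rm II}(A_n)$ are in bijection with almost positive roots (the normal vectors of the facets), hence with diagonals of $P_{n+3}$. Two facets of a polytope are parallel if they are distinct and the linear subspaces spanned by the differences of their points coincide. *)

theory Defs
  imports "HOL-Analysis.Analysis"
begin

section \<open>Roots of type A\<close>

text \<open>
  The ambient space of type \<open>A\<^sub>n\<close> is \<open>real ^ 'm\<close> with \<open>CARD('m) = n + 1\<close>. The parameter \<open>ix\<close> is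
  meant to be a bijection from \<open>{1..n+1}\<close> onto \<open>'m\<close>; it numbers the coordinates from 1 to n + 1.
\<close>

definition std_vec :: "(nat \<Rightarrow> 'm::finite) \<Rightarrow> nat \<Rightarrow> real ^ 'm" where
  "std_vec ix i = axis (ix i) 1"

definition sum_zero_space :: "(real ^ 'm::finite) set" where
  "sum_zero_space = {x. (\<Sum>j\<in>UNIV. x $ j) = 0}"

definition simple_root :: "(nat \<Rightarrow> 'm::finite) \<Rightarrow> nat \<Rightarrow> real ^ 'm" where
  "simple_root ix i = std_vec ix i - std_vec ix (i + 1)"

definition positive_roots :: "nat \<Rightarrow> (nat \<Rightarrow> 'm::finite) \<Rightarrow> (real ^ 'm) set" where
  "positive_roots n ix = {std_vec ix i - std_vec ix j | i j. 1 \<le> i \<and> i < j \<and> j \<le> n + 1}"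

definition almost_positive_roots :: "nat \<Rightarrow> (nat \<Rightarrow> 'm::finite) \<Rightarrow> (real ^ 'm) set" where
  "almost_positive_roots n ix =
     positive_roots n ix \<union> {- simple_root ix i | i. 1 \<le> i \<and> i \<le> n}"


section \<open>Diagonals of a convex polygon\<close>

text \<open>
  The vertices of the N-gon are labelled by 1, ..., N in cyclic order, and a diagonal is the set of
  its two (distinct, non-adjacent) end points.
\<close>

definition diagonals :: "nat \<Rightarrow> nat set set" where
  "diagonals N = {{a, b} | a b. 1 \<le> a \<and> a + 2 \<le> b \<and> b \<le> N \<and> \<not> (a = 1 \<and> b = N)}"

text \<open>
  Two diagonals of a convex polygon meet in its interior iff their end points interlace;
  \<open>crosses_iff_open_segments_meet\<close> below justifies this for every convex polygon.
\<close>

definition crosses :: "nat set \<Rightarrow> nat set \<Rightarrow> bool" where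
  "crosses d e \<longleftrightarrow> (\<exists>a b c f. d = {a, b} \<and> e = {c, f} \<and>
     (a < c \<and> c < b \<and> b < f \<or> c < a \<and> a < f \<and> f < b))"

text \<open>Twice the signed area of the triangle \<open>x y z\<close>.\<close>

definition orient :: "complex \<Rightarrow> complex \<Rightarrow> complex \<Rightarrow> real" where
  "orient x y z = (Re y - Re x) * (Im z - Im x) - (Im y - Im x) * (Re z - Re x)"

lemma orient_segment:
  "orient x y ((1 - t) *\<^sub>R u + t *\<^sub>R v) = (1 - t) * orient x y u + t * orient x y v"
  by (simp add: orient_def algebra_simps)

lemma orient_same_side_disjoint:
  assumes "0 \<le> s * orient A B C" "0 \<le> s * orient A B D"
    and "0 < s * orient A B C \<or> 0 < s * orient A B D"
  shows "open_segment A B \<inter> open_segment C D = {}"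
proof (rule ccontr)
  assume "\<not> ?thesis"
  then obtain z where z1: "z \<in> open_segment A B" and z2: "z \<in> open_segment C D" by auto
  from z1 obtain t where zt: "z = (1 - t) *\<^sub>R A + t *\<^sub>R B" by (auto simp: in_segment)
  from z2 obtain u where u: "0 < u" "u < 1" and zu: "z = (1 - u) *\<^sub>R C + u *\<^sub>R D"
    by (auto simp: in_segment)
  have "orient A B z = 0"
    unfolding zt orient_segment by (simp add: orient_def algebra_simps)
  then have "s * ((1 - u) * orient A B C + u * orient A B D) = 0"
    unfolding zu orient_segment by simp
  then have eq: "(1 - u) * (s * orient A B C) + u * (s * orient A B D) = 0"
    by (simp add: algebra_simps)
  have "0 \<le> (1 - u) * (s * orient A B C)" "0 \<le> u * (s * orient A B D)"
    using assms(1,2) u by simp_all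
  moreover have "0 < (1 - u) * (s * orient A B C) \<or> 0 < u * (s * orient A B D)"
    using assms(3) u mult_pos_pos[of "1 - u" "s * orient A B C"]
      mult_pos_pos[of u "s * orient A B D"] by force
  ultimately show False using eq by linarith
qed

lemma orient_quadrilateral_meet:
  assumes "0 < orient A C B" "0 < orient A B D" "0 < orient A C D" "0 < orient C B D"
  shows "open_segment A B \<inter> open_segment C D \<noteq> {}"
proof -
  define q where "q = orient A C B + orient A B D"
  have q': "q = orient A C D + orient C B D"
    by (simp add: q_def orient_def algebra_simps)
  define t u where "t = orient A C B / q" and "u = orient A C D / q"
  have q: "q > 0" using assms by (simp add: q_def)
  have t: "0 < t" "t < 1" using assms q by (auto simp: t_def q_def field_simps)
  have u: "0 < u" "u < 1" using assms q by (auto simp: u_def q' field_simps)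
  have qt: "q * t = orient A C B" and qu: "q * u = orient A C D"
    using q by (simp_all add: t_def u_def)
  have "q * Re ((1 - u) *\<^sub>R A + u *\<^sub>R B) = q * Re A + (q * u) * (Re B - Re A)"
    by (simp add: algebra_simps)
  also have "\<dots> = q * Re C + (q * t) * (Re D - Re C)"
    unfolding qt qu unfolding q_def orient_def by (simp add: algebra_simps)
  also have "\<dots> = q * Re ((1 - t) *\<^sub>R C + t *\<^sub>R D)"
    by (simp add: algebra_simps)
  finally have re: "Re ((1 - u) *\<^sub>R A + u *\<^sub>R B) = Re ((1 - t) *\<^sub>R C + t *\<^sub>R D)"
    using q by simp
  have "q * Im ((1 - u) *\<^sub>R A + u *\<^sub>R B) = q * Im A + (q * u) * (Im B - Im A)"
    by (simp add: algebra_simps)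
  also have "\<dots> = q * Im C + (q * t) * (Im D - Im C)"
    unfolding qt qu unfolding q_def orient_def by (simp add: algebra_simps)
  also have "\<dots> = q * Im ((1 - t) *\<^sub>R C + t *\<^sub>R D)"
    by (simp add: algebra_simps)
  finally have im: "Im ((1 - u) *\<^sub>R A + u *\<^sub>R B) = Im ((1 - t) *\<^sub>R C + t *\<^sub>R D)"
    using q by simp
  have eq: "(1 - u) *\<^sub>R A + u *\<^sub>R B = (1 - t) *\<^sub>R C + t *\<^sub>R D"
    using re im by (rule complex_eqI)
  have "A \<noteq> B" "C \<noteq> D" using assms by (auto simp: orient_def algebra_simps)
  then have "(1 - u) *\<^sub>R A + u *\<^sub>R B \<in> open_segment A B"
    and "(1 - t) *\<^sub>R C + t *\<^sub>R D \<in> open_segment C D"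
    using t u by (auto simp: in_segment)
  then show ?thesis using eq by auto
qed

text \<open>
  A polygon with counterclockwise vertices \<open>p 1, ..., p N\<close> is convex iff all the triangles
  \<open>p i, p j, p k\<close> with \<open>i < j < k\<close> are positively oriented.
\<close>

lemma crosses_iff_open_segments_meet:
  fixes p :: "nat \<Rightarrow> complex"
  assumes convex: "\<And>i j k. \<lbrakk>1 \<le> i; i < j; j < k; k \<le> N\<rbrakk> \<Longrightarrow> 0 < orient (p i) (p j) (p k)"
    and ab: "1 \<le> a" "a < b" "b \<le> N" and cf: "1 \<le> c" "c < f" "f \<le> N"
    and distinct: "{a, b} \<noteq> {c, f}"
  shows "crosses {a, b} {c, f} \<longleftrightarrow> open_segment (p a) (p b) \<inter> open_segment (p c) (p f) \<noteq> {}"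
proof -
  have cr: "crosses {a, b} {c, f} \<longleftrightarrow> a < c \<and> c < b \<and> b < f \<or> c < a \<and> a < f \<and> f < b"
    using ab cf unfolding crosses_def doubleton_eq_iff by fastforce
  have pos: "0 < orient (p a) (p b) (p k)" if "1 \<le> k" "k \<le> N" "k < a \<or> b < k" for k
  proof (cases "b < k")
    case True
    then show ?thesis using convex[of a b k] ab that by simp
  next
    case False
    then have "0 < orient (p k) (p a) (p b)" using convex[of k a b] ab that by simp
    then show ?thesis by (simp add: orient_def algebra_simps)
  qed
  have neg: "orient (p a) (p b) (p k) < 0" if "a < k" "k < b" for k
  proof -
    have "0 < orient (p a) (p k) (p b)" using convex[of a k b] ab that by simp
    then show ?thesis by (simp add: orient_def algebra_simps)
  qed
  have zero: "orient (p a) (p b) (p k) = 0" if "k = a \<or> k = b" for k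
    using that by (auto simp: orient_def algebra_simps)
  show ?thesis
  proof (cases "crosses {a, b} {c, f}")
    case True
    then consider "a < c" "c < b" "b < f" | "c < a" "a < f" "f < b" using cr by blast
    then have "open_segment (p a) (p b) \<inter> open_segment (p c) (p f) \<noteq> {}"
    proof cases
      case 1
      then show ?thesis using ab cf by (intro orient_quadrilateral_meet convex) auto
    next
      case 2
      then have "open_segment (p c) (p f) \<inter> open_segment (p a) (p b) \<noteq> {}"
        using ab cf by (intro orient_quadrilateral_meet convex) auto
      then show ?thesis by (simp add: Int_commute)
    qed
    then show ?thesis using True by simp
  next
    case False
    have *: "a \<le> c \<and> f \<le> b \<or> (c \<le> a \<or> b \<le> c) \<and> (f \<le> a \<or> b \<le> f)"
      using False cr ab cf by linarith
    have ne: "\<not> (c = a \<and> f = b)" using distinct by auto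
    from * have "open_segment (p a) (p b) \<inter> open_segment (p c) (p f) = {}"
    proof
      assume in_ab: "a \<le> c \<and> f \<le> b"
      have le: "orient (p a) (p b) (p k) \<le> 0" if "a \<le> k" "k \<le> b" for k
        using neg[of k] zero[of k] that by fastforce
      have "a < c \<and> c < b \<or> a < f \<and> f < b" using in_ab ne cf by linarith
      then show ?thesis
        using le[of c] le[of f] in_ab cf neg[of c] neg[of f]
        by (intro orient_same_side_disjoint[where s = "-1"]) auto
    next
      assume out: "(c \<le> a \<or> b \<le> c) \<and> (f \<le> a \<or> b \<le> f)"
      have ge: "0 \<le> orient (p a) (p b) (p k)" if "1 \<le> k" "k \<le> N" "k \<le> a \<or> b \<le> k" for k
        using pos[of k] zero[of k] that by fastforce
      have "(c < a \<or> b < c) \<or> (f < a \<or> b < f)" using out ne cf by linarith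
      then show ?thesis
        using ge[of c] ge[of f] out ab cf pos[of c] pos[of f]
        by (intro orient_same_side_disjoint[where s = 1]) auto
    qed
    then show ?thesis using False by simp
  qed
qed


section \<open>Almost positive roots as diagonals, and clusters\<close>

text \<open>The diagonal of \<open>- \<alpha>\<^sub>k\<close>; the two cases are \<open>k = 2i - 1\<close> and \<open>k = 2i\<close>.\<close>

definition snake_diagonal :: "nat \<Rightarrow> nat \<Rightarrow> nat set" where
  "snake_diagonal n k =
     (if odd k then {(k + 1) div 2, n + 3 - (k + 1) div 2} else {k div 2 + 1, n + 3 - k div 2})"

definition root_diagonal :: "nat \<Rightarrow> (nat \<Rightarrow> 'm::finite) \<Rightarrow> real ^ 'm \<Rightarrow> nat set" where
  "root_diagonal n ix \<beta> = (THE d.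
     (\<exists>i. 1 \<le> i \<and> i \<le> n \<and> \<beta> = - simple_root ix i \<and> d = snake_diagonal n i) \<or>
     (\<exists>i j. 1 \<le> i \<and> i \<le> j \<and> j \<le> n \<and> \<beta> = (\<Sum>k=i..j. simple_root ix k) \<and>
        d \<in> diagonals (n + 3) \<and>
        (\<forall>k\<in>{1..n}. crosses d (snake_diagonal n k) \<longleftrightarrow> i \<le> k \<and> k \<le> j)))"

definition compatible :: "nat \<Rightarrow> (nat \<Rightarrow> 'm::finite) \<Rightarrow> real ^ 'm \<Rightarrow> real ^ 'm \<Rightarrow> bool" where
  "compatible n ix \<beta> \<gamma> \<longleftrightarrow> \<not> crosses (root_diagonal n ix \<beta>) (root_diagonal n ix \<gamma>)"

definition compatible_set :: "nat \<Rightarrow> (nat \<Rightarrow> 'm::finite) \<Rightarrow> (real ^ 'm) set \<Rightarrow> bool" where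
  "compatible_set n ix C \<longleftrightarrow>
     C \<subseteq> almost_positive_roots n ix \<and> (\<forall>\<beta>\<in>C. \<forall>\<gamma>\<in>C. compatible n ix \<beta> \<gamma>)"

definition cluster :: "nat \<Rightarrow> (nat \<Rightarrow> 'm::finite) \<Rightarrow> (real ^ 'm) set \<Rightarrow> bool" where
  "cluster n ix C \<longleftrightarrow> compatible_set n ix C \<and> (\<forall>D. compatible_set n ix D \<and> C \<subseteq> D \<longrightarrow> D = C)"


section \<open>Normal fans and parallel facets\<close>

text \<open>
  Normals are outer normals, and the normal fan of a polytope contained in a linear subspace \<open>V\<close>
  is formed inside \<open>V\<close>.
\<close>

definition face_in_direction :: "'a::euclidean_space set \<Rightarrow> 'a \<Rightarrow> 'a set" where
  "face_in_direction P v = {x \<in> P. \<forall>y\<in>P. v \<bullet> y \<le> v \<bullet> x}"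

definition normal_cone :: "'a::euclidean_space set \<Rightarrow> 'a set \<Rightarrow> 'a set \<Rightarrow> 'a set" where
  "normal_cone V P F = {v \<in> V. F \<subseteq> face_in_direction P v}"

definition normal_fan :: "'a::euclidean_space set \<Rightarrow> 'a set \<Rightarrow> 'a set set" where
  "normal_fan V P = {normal_cone V P F | F. F face_of P \<and> F \<noteq> {}}"

definition maximal_cones :: "'a set set \<Rightarrow> 'a set set" where
  "maximal_cones \<F> = {K \<in> \<F>. \<forall>L\<in>\<F>. K \<subseteq> L \<longrightarrow> L = K}"

definition parallel_facets :: "'a::euclidean_space set \<Rightarrow> 'a set \<Rightarrow> 'a set \<Rightarrow> bool" where
  "parallel_facets P F G \<longleftrightarrow> F facet_of P \<and> G facet_of P \<and> F \<noteq> G \<and>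
     span {x - y | x y. x \<in> F \<and> y \<in> F} = span {x - y | x y. x \<in> G \<and> y \<in> G}"

definition parallel_facet_pairs :: "'a::euclidean_space set \<Rightarrow> 'a set set set" where
  "parallel_facet_pairs P = {{F, G} | F G. parallel_facets P F G}"

text \<open>
  The facet labelled by a diagonal: its normal vector is the almost positive root identified with
  that diagonal.
\<close>

definition facet_of_diagonal ::
    "nat \<Rightarrow> (nat \<Rightarrow> 'm::finite) \<Rightarrow> (real ^ 'm) set \<Rightarrow> nat set \<Rightarrow> (real ^ 'm) set" where
  "facet_of_diagonal n ix P d =
     face_in_direction P (inv_into (almost_positive_roots n ix) (root_diagonal n ix) d)"

end

theory Submission
  imports Defs
begin

text \<open>
  Let \<open>P\<close> be a polytope in \<open>V = sum_zero_space\<close> with the prescribed normal fan. Say that a set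
  spans \<open>V\<close> if the differences of its points do. A facet of a polytope that spans \<open>V\<close> has an outer normal
  in \<open>V\<close>, unique up to a positive factor, and the directions inside the facet form the hyperplane of
  \<open>V\<close> orthogonal to that normal. So two distinct facets are parallel
  iff their normals point in opposite directions, and everything rests on knowing the facet normals.

  Every facet normal is an almost positive root: it lies in some maximal cone of the fan, this cone is
  generated by a cluster, and a facet normal in the normal cone of a face can be replaced by one of the
  generators (\<open>facet_normal_among_generators\<close>). All almost positive roots have the same length, so
  parallel facets have normals \<open>\<beta>\<close> and \<open>- \<beta>\<close> that are both almost positive roots. This leaves only
  \<open>{\<alpha>\<^sub>i, - \<alpha>\<^sub>i}\<close>, because the negative roots among the almost positive ones are the negative simple ones.

  Conversely \<open>\<alpha>\<^sub>i\<close> and \<open>- \<alpha>\<^sub>i\<close> have to be facet normals. The fan need not be understood completely for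
  this: a linearly independent set that generates the normal cone of some face consists of facet
  normals (\<open>simplicial_cone_generators_are_facet_normals\<close>), so it suffices to exhibit one linearly
  independent cluster containing each of these roots. The negative simple roots form a cluster, and so
  does the set obtained from them by replacing \<open>- \<alpha>\<^sub>i\<close> by \<open>\<alpha>\<^sub>i\<close> (\<open>cluster_flipped_snake\<close>): the
  diagonal of any further almost positive root crosses the diagonal of one of its elements. The first of these
  clusters also shows that \<open>P\<close> spans \<open>V\<close>, since it generates a pointed cone.

  The polygon enters through the order of its vertices along the snake \<open>s\<^sub>0, s\<^sub>1, ..., s\<^sub>n\<^sub>+\<^sub>2\<close>. For
  \<open>p < q\<close>, the chord from \<open>s\<^sub>p\<close> to \<open>s\<^sub>q\<close> crosses exactly the snake diagonals \<open>p + 1, ..., q - 2\<close>. Hence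
  the diagonal of \<open>\<alpha>\<^sub>i + ... + \<alpha>\<^sub>j\<close> exists, is unique and joins \<open>s\<^sub>i\<^sub>-\<^sub>1\<close> to \<open>s\<^sub>j\<^sub>+\<^sub>2\<close>, distinct almost
  positive roots have distinct diagonals, and compatibility with \<open>- \<alpha>\<^sub>k\<close> can be read off the interval.
\<close>

section \<open>Directions of a set and its faces\<close>

definition directions :: "'a::euclidean_space set \<Rightarrow> 'a set" where
  "directions S = span {x - y | x y. x \<in> S \<and> y \<in> S}"

lemma directions_mono: "S \<subseteq> T \<Longrightarrow> directions S \<subseteq> directions T"
  unfolding directions_def by (intro span_mono) blast

lemma diff_in_directions: "x \<in> S \<Longrightarrow> y \<in> S \<Longrightarrow> x - y \<in> directions S"
  unfolding directions_def by (intro span_base) blast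

lemma dim_directions:
  assumes "S \<noteq> {}"
  shows "int (dim (directions S)) = aff_dim S"
proof -
  obtain a where a: "a \<in> S" using assms by blast
  have "directions S = span ((\<lambda>x. x - a) ` S)"
  proof
    have "x - y \<in> span ((\<lambda>x. x - a) ` S)" if "x \<in> S" "y \<in> S" for x y
    proof -
      have "(x - a) - (y - a) \<in> span ((\<lambda>x. x - a) ` S)"
        using that by (intro span_diff span_base) auto
      then show ?thesis by simp
    qed
    then show "directions S \<subseteq> span ((\<lambda>x. x - a) ` S)"
      unfolding directions_def by (intro span_minimal) auto
    show "span ((\<lambda>x. x - a) ` S) \<subseteq> directions S"
      unfolding directions_def using a by (intro span_mono) auto
  qed
  then show ?thesis
    using aff_dim_eq_dim_subtract[of a S] a by (simp add: hull_inc)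
qed

text \<open>
  If the directions formed a proper subspace of \<open>V\<close>, a nonzero vector of \<open>V\<close> would be orthogonal to it.
\<close>

lemma directions_eqI:
  assumes "subspace V" "P \<subseteq> V"
    and lineality: "\<And>v. v \<in> V \<Longrightarrow> (\<And>x y. x \<in> P \<Longrightarrow> y \<in> P \<Longrightarrow> v \<bullet> x = v \<bullet> y) \<Longrightarrow> v = 0"
  shows "directions P = V"
proof (rule ccontr)
  assume "directions P \<noteq> V"
  moreover have "directions P \<subseteq> V"
    unfolding directions_def using assms(1,2)
    by (intro span_minimal) (auto intro: subspace_diff)
  moreover have "span V = V" using assms(1) by (simp add: span_eq_iff)
  ultimately have "span {x - y | x y. x \<in> P \<and> y \<in> P} \<subset> span V"
    unfolding directions_def by blast
  then obtain v where v: "v \<noteq> 0" "v \<in> span V"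
      "\<And>z. z \<in> span {x - y | x y. x \<in> P \<and> y \<in> P} \<Longrightarrow> orthogonal v z"
    by (rule orthogonal_to_subspace_exists_gen) blast
  have "v \<bullet> x = v \<bullet> y" if "x \<in> P" "y \<in> P" for x y
  proof -
    have "orthogonal v (x - y)" using that by (intro v(3) span_base) auto
    then show ?thesis by (simp add: orthogonal_def inner_diff_right)
  qed
  then show False using lineality[of v] v \<open>span V = V\<close> by blast
qed

lemma directions_subset_hyperplane:
  assumes "\<And>x y. x \<in> S \<Longrightarrow> y \<in> S \<Longrightarrow> v \<bullet> x = v \<bullet> y"
  shows "directions S \<subseteq> {z. v \<bullet> z = 0}"
  unfolding directions_def
proof (intro span_minimal subspace_hyperplane subsetI)
  fix z assume "z \<in> {x - y | x y. x \<in> S \<and> y \<in> S}"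
  then obtain x y where "z = x - y" "x \<in> S" "y \<in> S" by blast
  then show "z \<in> {z. v \<bullet> z = 0}" using assms[of x y] by (simp add: inner_diff_right)
qed

lemma constant_on_imp_zero:
  assumes "v \<in> directions P" "\<And>x y. x \<in> P \<Longrightarrow> y \<in> P \<Longrightarrow> v \<bullet> x = v \<bullet> y"
  shows "v = 0"
proof -
  have "directions P \<subseteq> {z. v \<bullet> z = 0}"
    using directions_subset_hyperplane[OF assms(2)] .
  then show ?thesis using assms(1) by auto
qed

lemma mem_face_in_direction:
  "x \<in> face_in_direction P v \<longleftrightarrow> x \<in> P \<and> (\<forall>y\<in>P. v \<bullet> y \<le> v \<bullet> x)"
  by (simp add: face_in_direction_def)

lemma inner_eq_on_face_in_direction:
  "x \<in> face_in_direction P v \<Longrightarrow> y \<in> face_in_direction P v \<Longrightarrow> v \<bullet> x = v \<bullet> y"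
  by (meson mem_face_in_direction order_antisym)

lemma face_in_direction_eq_hyperplane:
  assumes "x \<in> face_in_direction P v"
  shows "face_in_direction P v = P \<inter> {y. v \<bullet> y = v \<bullet> x}"
  using assms by (auto simp: face_in_direction_def intro: order_antisym)

lemma face_in_direction_face_of:
  assumes "convex P"
  shows "face_in_direction P v face_of P"
proof (cases "face_in_direction P v = {}")
  case False
  then obtain x where x: "x \<in> face_in_direction P v" by blast
  show ?thesis
    unfolding face_in_direction_eq_hyperplane[OF x]
    using assms x by (intro face_of_Int_supporting_hyperplane_le) (auto simp: mem_face_in_direction)
qed simp

lemma face_in_direction_nonempty:
  assumes "compact P" "P \<noteq> {}"
  shows "face_in_direction P v \<noteq> {}"
proof -
  have "continuous_on P (\<lambda>y. v \<bullet> y)" by (intro continuous_intros)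
  then obtain x where "x \<in> P" "\<forall>y\<in>P. v \<bullet> y \<le> v \<bullet> x"
    using continuous_attains_sup[OF assms] by blast
  then show ?thesis by (auto simp: face_in_direction_def)
qed

lemma face_in_direction_scaleR:
  "c > 0 \<Longrightarrow> face_in_direction P (c *\<^sub>R v) = face_in_direction P v"
  by (auto simp: face_in_direction_def)

text \<open>
  Once two linear functionals attain their maxima over \<open>P\<close> at a common point, their sum is maximal
  exactly where both are.
\<close>

lemma face_in_direction_add:
  assumes "x \<in> face_in_direction P v" "x \<in> face_in_direction P w"
  shows "face_in_direction P (v + w) = face_in_direction P v \<inter> face_in_direction P w"
proof
  show "face_in_direction P (v + w) \<subseteq> face_in_direction P v \<inter> face_in_direction P w"
  proof
    fix y assume y: "y \<in> face_in_direction P (v + w)"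
    have "v \<bullet> x + w \<bullet> x \<le> v \<bullet> y + w \<bullet> y" "v \<bullet> y \<le> v \<bullet> x" "w \<bullet> y \<le> w \<bullet> x"
      using assms y by (auto simp: mem_face_in_direction inner_add_left)
    then have "v \<bullet> y = v \<bullet> x" "w \<bullet> y = w \<bullet> x" by linarith+
    then show "y \<in> face_in_direction P v \<inter> face_in_direction P w"
      using assms y by (auto simp: mem_face_in_direction)
  qed
qed (simp add: subset_iff mem_face_in_direction inner_add_left add_mono)

text \<open>
  There is no room for a face strictly between a facet and \<open>P\<close>: the affine dimension grows strictly
  along a chain of faces.
\<close>

lemma facet_subset_proper_face:
  assumes "convex P" "F facet_of P" "G face_of P" "G \<noteq> P" "F \<subseteq> G"
  shows "F = G"
proof (rule ccontr)
  assume "F \<noteq> G"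
  have "F face_of G"
    using assms by (meson face_of_face face_of_imp_subset facet_of_imp_face_of face_of_subset)
  then have "aff_dim F < aff_dim G"
    using \<open>F \<noteq> G\<close> assms face_of_aff_dim_lt face_of_imp_convex by blast
  moreover have "aff_dim G < aff_dim P"
    using assms by (intro face_of_aff_dim_lt)
  ultimately show False using assms(2) by (auto simp: facet_of_def)
qed

lemma face_in_direction_proper:
  assumes "v \<in> directions P" "v \<noteq> 0"
  shows "face_in_direction P v \<noteq> P"
proof
  assume "face_in_direction P v = P"
  then have "v \<bullet> x = v \<bullet> y" if "x \<in> P" "y \<in> P" for x y
    using that by (intro inner_eq_on_face_in_direction[of x P v y]) auto
  then have "v = 0" by (rule constant_on_imp_zero[OF assms(1)])
  then show False using assms(2) by simp
qed

section \<open>Facets and their normals\<close>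

text \<open>
  The inclusion of the left side in the right side holds for every face; the facet condition says
  that the dimensions agree.
\<close>

lemma directions_facet:
  assumes facet: "face_in_direction P w facet_of P" and w: "w \<in> directions P"
  shows "directions (face_in_direction P w) = {x \<in> directions P. w \<bullet> x = 0}"
proof -
  let ?F = "face_in_direction P w" and ?H = "{x \<in> directions P. w \<bullet> x = 0}"
  have ne: "?F \<noteq> {}" "?F \<subseteq> P" "P \<noteq> {}" and aff: "aff_dim ?F = aff_dim P - 1"
    using facet by (auto simp: facet_of_def face_in_direction_def)
  have "w \<noteq> 0" using facet by (auto simp: face_in_direction_def)
  have sub: "subspace (directions S)" for S :: "'a set" by (simp add: directions_def)
  have "?H = {y \<in> directions P. \<forall>x \<in> span {w}. orthogonal x y}"
    by (auto simp: orthogonal_def span_singleton)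
  moreover have "span {w} \<subseteq> directions P" using w sub by (intro span_minimal) auto
  ultimately have "dim ?H + dim (span {w}) = dim (directions P)"
    using dim_subspace_orthogonal_to_vectors[of "span {w}" "directions P"] sub by simp
  then have "dim ?H = dim (directions ?F)"
    using dim_directions[OF ne(1)] dim_directions[OF ne(3)] aff \<open>w \<noteq> 0\<close> by simp
  moreover have "directions ?F \<subseteq> ?H"
  proof -
    have "directions ?F \<subseteq> {x. w \<bullet> x = 0}"
      by (intro directions_subset_hyperplane inner_eq_on_face_in_direction)
    then show ?thesis using directions_mono[OF ne(2)] by auto
  qed
  moreover have "subspace ?H"
    using sub subspace_hyperplane[of w] subspace_inter[of "directions P" "{x. w \<bullet> x = 0}"]
    by (simp add: Collect_conj_eq)
  ultimately show ?thesis
    using sub by (intro subspace_dim_equal) auto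
qed

text \<open>
  The component of \<open>w\<close> orthogonal to \<open>v\<close> lies in \<open>V\<close> and is orthogonal to \<open>v\<close>, hence also to \<open>w\<close>, hence
  to itself.
\<close>

lemma same_orthogonal_imp_collinear:
  assumes "subspace V" "v \<in> V" "w \<in> V" "v \<noteq> 0"
    and "{x \<in> V. v \<bullet> x = 0} \<subseteq> {x \<in> V. w \<bullet> x = 0}"
  obtains c where "w = c *\<^sub>R v"
proof -
  define c where "c = (w \<bullet> v) / (v \<bullet> v)"
  define u where "u = w - c *\<^sub>R v"
  have "v \<bullet> u = 0" using assms(4) by (simp add: u_def c_def inner_diff_right inner_commute)
  moreover have "u \<in> V" unfolding u_def using assms by (intro subspace_diff subspace_scale)
  ultimately have "w \<bullet> u = 0" using assms(5) by auto
  then have "u \<bullet> u = 0" using \<open>v \<bullet> u = 0\<close> by (simp add: u_def inner_diff_left)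
  then show ?thesis using that[of c] by (simp add: u_def)
qed

text \<open>
  Facets of a polytope are exposed. The exposing functional is an arbitrary vector of the ambient
  space; its orthogonal projection onto the directions of \<open>P\<close> differs from it by a constant on \<open>P\<close>.
\<close>

lemma facet_normal_exists:
  assumes "polytope P" "G facet_of P"
  obtains w where "w \<in> directions P" "w \<noteq> 0" "G = face_in_direction P w"
proof -
  have "G exposed_face_of P"
    using assms exposed_face_of_polyhedron polytope_imp_polyhedron facet_of_imp_face_of by blast
  then obtain a b where ab: "P \<subseteq> {x. a \<bullet> x \<le> b}" "G = P \<inter> {x. a \<bullet> x = b}"
    unfolding exposed_face_of_def by blast
  obtain z where z: "z \<in> G" using assms(2) by (auto simp: facet_of_def)
  have G: "G = face_in_direction P a"
  proof -
    have "z \<in> P" "a \<bullet> z = b" using z ab(2) by auto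
    then have "z \<in> face_in_direction P a" using ab(1) by (auto simp: mem_face_in_direction)
    from face_in_direction_eq_hyperplane[OF this] show ?thesis
      by (simp add: ab(2) \<open>a \<bullet> z = b\<close>)
  qed
  obtain w u where wu: "w \<in> span (directions P)" "\<And>x. x \<in> span (directions P) \<Longrightarrow> orthogonal u x"
      "a = w + u"
    by (rule orthogonal_subspace_decomp_exists[of "directions P" a]) blast
  have w: "w \<in> directions P" using wu(1) by (simp only: directions_def span_span)
  have eq: "a \<bullet> y - a \<bullet> x = w \<bullet> y - w \<bullet> x" if "x \<in> P" "y \<in> P" for x y
  proof -
    have "orthogonal u (y - x)" using that by (intro wu(2) span_base diff_in_directions)
    then have "a \<bullet> (y - x) = w \<bullet> (y - x)" by (simp add: wu(3) inner_add_left orthogonal_def)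
    then show ?thesis by (simp add: inner_diff_right)
  qed
  have "G = face_in_direction P w"
  proof -
    have "(a \<bullet> y \<le> a \<bullet> x) = (w \<bullet> y \<le> w \<bullet> x)" if "x \<in> P" "y \<in> P" for x y
      using eq[OF that] by linarith
    then show ?thesis unfolding G face_in_direction_def by blast
  qed
  moreover have "w \<noteq> 0"
    using calculation assms(2) by (auto simp: face_in_direction_def)
  ultimately show ?thesis using that w by blast
qed

section \<open>Generators of normal cones\<close>

lemma convex_cone_hull_nonneg:
  assumes "linear f" "\<And>c. c \<in> C \<Longrightarrow> 0 \<le> f c" "w \<in> convex_cone hull C"
  shows "0 \<le> (f w :: real)"
proof -
  have "convex_cone {x. 0 \<le> f x}"
    using assms(1) by (auto simp: convex_cone_iff linear_0 linear_add linear_scale)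
  then have "convex_cone hull C \<subseteq> {x. 0 \<le> f x}"
    using assms(2) by (intro hull_minimal) auto
  then show ?thesis using assms(3) by auto
qed

text \<open>
  By linear independence some linear functional is 1 on all of \<open>C\<close>, and it is positive on the
  cone except at 0.
\<close>

lemma convex_cone_hull_independent_pointed:
  fixes C :: "'a::euclidean_space set"
  assumes "independent C" "v \<in> convex_cone hull C" "- v \<in> convex_cone hull C"
  shows "v = 0"
proof -
  obtain f :: "'a \<Rightarrow> real" where f: "linear f" "\<And>c. c \<in> C \<Longrightarrow> f c = 1"
    using linear_independent_extend[OF assms(1), of "\<lambda>_. 1"] by blast
  have "convex_cone {x. x = 0 \<or> 0 < f x}"
    using f(1) unfolding convex_cone_iff
    by (auto simp: linear_0 linear_add linear_scale add_pos_pos less_eq_real_def)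
  then have "convex_cone hull C \<subseteq> {x. x = 0 \<or> 0 < f x}"
    using f(2) by (intro hull_minimal) auto
  then have "v = 0 \<or> 0 < f v" "- v = 0 \<or> 0 < f (- v)" using assms(2,3) by blast+
  then show ?thesis using linear_neg[OF f(1), of v] by auto
qed

text \<open>
  If \<open>w\<close> is a nonnegative combination of functionals that are all maximal at \<open>x\<close>, then the points where
  \<open>w\<close> is maximal are those where all functionals with a positive coefficient are. Instead of
  coefficients, the proof uses that the vectors with the desired property form a convex cone together
  with 0.
\<close>

lemma face_in_direction_subset_generator:
  assumes "w \<in> convex_cone hull C" "w \<noteq> 0" "\<And>c. c \<in> C \<Longrightarrow> x \<in> face_in_direction P c" "x \<in> P"
  obtains c where "c \<in> C" "face_in_direction P w \<subseteq> face_in_direction P c"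
proof -
  let ?K = "{w. x \<in> face_in_direction P w \<and>
               (w = 0 \<or> (\<exists>c\<in>C. face_in_direction P w \<subseteq> face_in_direction P c))}"
  have "convex_cone ?K"
    unfolding convex_cone_iff
  proof (intro conjI ballI allI impI)
    show "0 \<in> ?K" using assms(4) by (auto simp: mem_face_in_direction)
  next
    fix v w assume "v \<in> ?K" "w \<in> ?K"
    then show "v + w \<in> ?K" by (auto simp: face_in_direction_add[of x])
  next
    fix v and c :: real assume "v \<in> ?K" "0 \<le> c"
    then show "c *\<^sub>R v \<in> ?K"
      using assms(4) face_in_direction_scaleR[of c P v]
      by (cases "c = 0") (auto simp: mem_face_in_direction)
  qed
  then have "convex_cone hull C \<subseteq> ?K" using assms(3) by (intro hull_minimal) auto
  then show ?thesis using assms(1,2) that by auto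
qed

text \<open>
  Tilting \<open>v\<close> slightly along \<open>- w\<close> loses no maximum of \<open>v\<close>: on the face in direction \<open>v\<close> the functional
  \<open>w\<close> is constant, and the finitely many vertices off that face stay strictly below.
\<close>

lemma face_in_direction_perturb:
  assumes "polytope P" "face_in_direction P v \<subseteq> face_in_direction P w" "face_in_direction P v \<noteq> {}"
  obtains e where "e > 0" "face_in_direction P v \<subseteq> face_in_direction P (v - e *\<^sub>R w)"
proof -
  obtain S where S: "finite S" "P = convex hull S" using assms(1) by (auto simp: polytope_def)
  obtain x where x: "x \<in> face_in_direction P v" using assms(3) by blast
  have "\<exists>e>0. \<forall>y\<in>S. (v - e *\<^sub>R w) \<bullet> y \<le> (v - e *\<^sub>R w) \<bullet> x"
  proof -
    have "\<forall>y\<in>S. eventually (\<lambda>e. (v - e *\<^sub>R w) \<bullet> y \<le> (v - e *\<^sub>R w) \<bullet> x) (at_right (0::real))"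
    proof
      fix y assume "y \<in> S"
      then have yP: "y \<in> P" using S by (simp add: hull_inc)
      show "eventually (\<lambda>e. (v - e *\<^sub>R w) \<bullet> y \<le> (v - e *\<^sub>R w) \<bullet> x) (at_right (0::real))"
      proof (cases "y \<in> face_in_direction P v")
        case True
        then have "v \<bullet> y = v \<bullet> x" "w \<bullet> y = w \<bullet> x"
          using x assms(2) inner_eq_on_face_in_direction by blast+
        then show ?thesis by (simp add: inner_diff_left)
      next
        case False
        then have "v \<bullet> y \<noteq> v \<bullet> x"
          using yP unfolding face_in_direction_eq_hyperplane[OF x] by simp
        moreover have "v \<bullet> y \<le> v \<bullet> x" using x yP by (simp add: mem_face_in_direction)
        ultimately have "v \<bullet> y < v \<bullet> x" by simp
        moreover have "((\<lambda>e. (v - e *\<^sub>R w) \<bullet> (y - x)) \<longlongrightarrow> (v - 0 *\<^sub>R w) \<bullet> (y - x)) (at_right (0::real))"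
          by (intro tendsto_intros)
        ultimately have "eventually (\<lambda>e. (v - e *\<^sub>R w) \<bullet> (y - x) < 0) (at_right (0::real))"
          by (intro order_tendstoD(2)) (auto simp: inner_diff_right)
        then show ?thesis by eventually_elim (simp add: inner_diff_right)
      qed
    qed
    then have "eventually (\<lambda>e. \<forall>y\<in>S. (v - e *\<^sub>R w) \<bullet> y \<le> (v - e *\<^sub>R w) \<bullet> x) (at_right (0::real))"
      using S(1) by (simp add: eventually_ball_finite)
    then have "eventually (\<lambda>e. 0 < e \<and> (\<forall>y\<in>S. (v - e *\<^sub>R w) \<bullet> y \<le> (v - e *\<^sub>R w) \<bullet> x)) (at_right (0::real))"
      using eventually_at_right_less by eventually_elim auto
    from eventually_happens'[OF _ this] show ?thesis by simp
  qed
  then obtain e where e: "e > 0" "\<forall>y\<in>S. (v - e *\<^sub>R w) \<bullet> y \<le> (v - e *\<^sub>R w) \<bullet> x" by blast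
  have "P \<subseteq> {y. (v - e *\<^sub>R w) \<bullet> y \<le> (v - e *\<^sub>R w) \<bullet> x}"
    unfolding S(2) using e(2) by (intro hull_minimal) (auto simp: convex_halfspace_le)
  then have xe: "x \<in> face_in_direction P (v - e *\<^sub>R w)" using x by (auto simp: mem_face_in_direction)
  have "z \<in> face_in_direction P (v - e *\<^sub>R w)" if z: "z \<in> face_in_direction P v" for z
  proof -
    have "v \<bullet> z = v \<bullet> x" "w \<bullet> z = w \<bullet> x"
      using x z assms(2) inner_eq_on_face_in_direction by blast+
    then show ?thesis
      using xe z by (auto simp: mem_face_in_direction inner_diff_left)
  qed
  then show ?thesis using that e(1) by blast
qed

text \<open>
  The facet is contained in the face of some generator of the cone by
  \<open>face_in_direction_subset_generator\<close>; this face is proper, so the two are equal.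
\<close>

lemma facet_normal_among_generators:
  assumes "polytope P" "C \<subseteq> directions P - {0}" "F \<noteq> {}" "F \<subseteq> P"
    and cone: "normal_cone V P F = convex_cone hull C"
    and w: "w \<in> convex_cone hull C" and facet: "face_in_direction P w facet_of P"
  obtains c where "c \<in> C" "face_in_direction P w = face_in_direction P c"
proof -
  obtain x where x: "x \<in> F" "x \<in> P" using assms(3,4) by blast
  have xC: "x \<in> face_in_direction P c" if "c \<in> C" for c
  proof -
    have "c \<in> normal_cone V P F" unfolding cone using that by (rule hull_inc)
    then show ?thesis using x by (auto simp: normal_cone_def)
  qed
  have "w \<noteq> 0" using facet by (auto simp: face_in_direction_def)
  then obtain c where c: "c \<in> C" "face_in_direction P w \<subseteq> face_in_direction P c"
    using face_in_direction_subset_generator[OF w _ xC] x by blast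
  have "convex P" using assms(1) by (rule polytope_imp_convex)
  have "face_in_direction P w = face_in_direction P c"
    using c assms(2)
    by (intro facet_subset_proper_face[OF \<open>convex P\<close> facet] face_in_direction_face_of \<open>convex P\<close>
        face_in_direction_proper) auto
  then show ?thesis using that c(1) by blast
qed

text \<open>
  The face in direction \<open>v\<close> lies in a facet, whose normal may be taken to be a generator \<open>c\<close>. If
  \<open>c \<noteq> v\<close>, then \<open>v - e c\<close> still supports \<open>P\<close> at \<open>F\<close> for some \<open>e > 0\<close> and so belongs to the cone,
  although its coefficient at the generator \<open>c\<close> is negative. This contradicts linear independence.
\<close>

lemma simplicial_cone_generators_are_facet_normals:
  assumes "polytope P" "C \<subseteq> directions P" "directions P = V" "independent C" "F \<noteq> {}" "F \<subseteq> P"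
    and cone: "normal_cone V P F = convex_cone hull C" and v: "v \<in> C"
  shows "face_in_direction P v facet_of P"
proof -
  have C0: "C \<subseteq> directions P - {0}"
    using assms(2,4) dependent_zero by blast
  have F: "F \<subseteq> face_in_direction P c" if "c \<in> convex_cone hull C" for c
    using that unfolding cone[symmetric] by (simp add: normal_cone_def)
  have Fv: "F \<subseteq> face_in_direction P v" using v by (intro F hull_inc)
  have conv: "convex P" using assms(1) by (rule polytope_imp_convex)
  obtain G where G: "G facet_of P" "face_in_direction P v \<subseteq> G"
  proof (rule face_of_polyhedron_subset_facet)
    show "polyhedron P" using assms(1) by (rule polytope_imp_polyhedron)
    show "face_in_direction P v face_of P" using conv by (rule face_in_direction_face_of)
    show "face_in_direction P v \<noteq> {}" using Fv assms(5) by blast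
    show "face_in_direction P v \<noteq> P" using C0 v by (intro face_in_direction_proper) auto
  qed blast
  obtain w where w: "w \<in> V" "G = face_in_direction P w"
    using facet_normal_exists[OF assms(1) G(1)] assms(3) by blast
  have "w \<in> normal_cone V P F" using w G(2) Fv by (auto simp: normal_cone_def)
  then obtain c where c: "c \<in> C" "G = face_in_direction P c"
    using facet_normal_among_generators[OF assms(1) C0 assms(5,6) cone, of w] w G(1) cone by auto
  have "c = v"
  proof (rule ccontr)
    assume "c \<noteq> v"
    obtain e where e: "e > 0" "face_in_direction P v \<subseteq> face_in_direction P (v - e *\<^sub>R c)"
      using face_in_direction_perturb[OF assms(1), of v c] G(2) c(2) Fv assms(5) by blast
    have "v - e *\<^sub>R c \<in> V"
      using v c(1) assms(2,3) unfolding directions_def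
      by (metis (no_types, lifting) in_mono span_diff span_scale)
    then have mem: "v - e *\<^sub>R c \<in> convex_cone hull C"
      using e(2) Fv by (auto simp: cone[symmetric] normal_cone_def)
    \<comment> \<open>The coordinate at \<open>c\<close> is nonnegative on the cone.\<close>
    obtain f :: "'a \<Rightarrow> real" where f: "linear f" "\<And>u. u \<in> C \<Longrightarrow> f u = (if u = c then 1 else 0)"
      using linear_independent_extend[OF assms(4), of "\<lambda>u. if u = c then 1 else 0"] by blast
    have "0 \<le> f (v - e *\<^sub>R c)"
      using f(2) by (intro convex_cone_hull_nonneg[OF f(1) _ mem]) auto
    also have "f (v - e *\<^sub>R c) = - e"
      using f c(1) v \<open>c \<noteq> v\<close> by (simp add: linear_diff linear_scale)
    finally show False using e(1) by simp
  qed
  then show ?thesis using G(1) c(2) by simp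
qed

text \<open>
  The fan covers \<open>V\<close>: \<open>w\<close> lies in the normal cone of the face on which it is maximal, and a polytope has
  only finitely many normal cones.
\<close>

lemma in_maximal_normal_cone:
  assumes "polytope P" "P \<noteq> {}" "w \<in> V"
  obtains K where "K \<in> maximal_cones (normal_fan V P)" "w \<in> K"
proof -
  let ?N = "normal_cone V P (face_in_direction P w)"
  have "finite (normal_fan V P)"
    unfolding normal_fan_def using finite_polytope_faces[OF assms(1)]
    by (simp add: setcompr_eq_image)
  moreover have "?N \<in> normal_fan V P"
    unfolding normal_fan_def
    using face_in_direction_face_of[OF polytope_imp_convex[OF assms(1)]]
      face_in_direction_nonempty[OF polytope_imp_compact[OF assms(1)] assms(2)] by blast
  ultimately have "\<exists>K\<in>normal_fan V P. ?N \<subseteq> K \<and> (\<forall>L\<in>normal_fan V P. K \<subseteq> L \<longrightarrow> K = L)"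
    by (rule finite_has_maximal2)
  then obtain K where K: "K \<in> normal_fan V P" "?N \<subseteq> K"
      "\<And>L. L \<in> normal_fan V P \<Longrightarrow> K \<subseteq> L \<Longrightarrow> K = L"
    by blast
  moreover have "w \<in> ?N" using assms(3) by (simp add: normal_cone_def)
  ultimately show ?thesis using that[of K] by (auto simp: maximal_cones_def dest: K(3))
qed

text \<open>
  A functional that is constant on \<open>P\<close> belongs, together with its negative, to the normal cone of every
  face. One pointed cone in the fan therefore forces \<open>P\<close> to span \<open>V\<close>.
\<close>

lemma directions_eq_if_pointed_normal_cone:
  assumes "subspace V" "P \<subseteq> V" "F \<subseteq> P" "independent C"
    and cone: "normal_cone V P F = convex_cone hull C"
  shows "directions P = V"
proof (rule directions_eqI[OF assms(1,2)])
  fix v assume v: "v \<in> V" and const: "\<And>x y. x \<in> P \<Longrightarrow> y \<in> P \<Longrightarrow> v \<bullet> x = v \<bullet> y"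
  have "P \<subseteq> face_in_direction P v" "P \<subseteq> face_in_direction P (- v)"
    unfolding subset_iff mem_face_in_direction inner_minus_left
    using eq_refl[OF const] by simp_all
  then have F: "F \<subseteq> face_in_direction P v" "F \<subseteq> face_in_direction P (- v)"
    using assms(3) by blast+
  have "v \<in> normal_cone V P F" "- v \<in> normal_cone V P F"
    using v F subspace_neg[OF assms(1)] by (auto simp: normal_cone_def)
  then show "v = 0"
    unfolding cone by (rule convex_cone_hull_independent_pointed[OF assms(4)])
qed

lemma facets_same_directions_imp_collinear_normals:
  assumes "face_in_direction P v facet_of P" "v \<in> directions P"
    and "face_in_direction P w facet_of P" "w \<in> directions P"
    and "directions (face_in_direction P v) = directions (face_in_direction P w)"
  obtains c where "w = c *\<^sub>R v"
proof (rule same_orthogonal_imp_collinear[of "directions P" v w])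
  show "subspace (directions P)" by (simp add: directions_def)
  show "v \<noteq> 0" using assms(1) by (auto simp: face_in_direction_def)
  show "{x \<in> directions P. v \<bullet> x = 0} \<subseteq> {x \<in> directions P. w \<bullet> x = 0}"
    using directions_facet[OF assms(1,2)] directions_facet[OF assms(3,4)] assms(5) by simp
qed (use assms that in auto)

text \<open>
  A functional that is maximal and minimal at the same point of \<open>P\<close> is constant on \<open>P\<close>.
\<close>

lemma face_in_direction_uminus_neq:
  assumes "v \<in> directions P" "v \<noteq> 0" "face_in_direction P v \<noteq> {}"
  shows "face_in_direction P v \<noteq> face_in_direction P (- v)"
proof
  assume eq: "face_in_direction P v = face_in_direction P (- v)"
  obtain x where x: "x \<in> face_in_direction P v" using assms(3) by blast
  have "v \<bullet> y = v \<bullet> x" if "y \<in> P" for y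
  proof (rule order_antisym)
    show "v \<bullet> y \<le> v \<bullet> x" using x that by (simp add: mem_face_in_direction)
    have "x \<in> face_in_direction P (- v)" using x eq by blast
    then show "v \<bullet> x \<le> v \<bullet> y" using that by (simp add: mem_face_in_direction)
  qed
  then have "face_in_direction P v = P"
    unfolding face_in_direction_eq_hyperplane[OF x] by blast
  then show False using face_in_direction_proper[OF assms(1,2)] by blast
qed


section \<open>The snake and the diagonals of the polygon\<close>

text \<open>
  The vertices of the polygon in the order in which the zigzag visits them, extended by one boundary
  edge at either end so that all \<open>n + 3\<close> vertices occur: vertex 0 is \<open>n + 3\<close>, and odd positions run
  upwards from 1 while even positions run downwards from \<open>n + 3\<close>.
\<close>

definition snake_vertex :: "nat \<Rightarrow> nat \<Rightarrow> nat" where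
  "snake_vertex n m = (if odd m then (m + 1) div 2 else n + 3 - m div 2)"

lemma snake_vertex_less_iff:
  assumes "p \<le> n + 2" "q \<le> n + 2"
  shows "snake_vertex n p < snake_vertex n q \<longleftrightarrow>
    (odd p \<and> (even q \<or> p < q)) \<or> (even p \<and> even q \<and> q < p)"
proof -
  obtain a b where "p = 2 * a \<or> p = 2 * a + 1" "q = 2 * b \<or> q = 2 * b + 1"
    by (metis oddE evenE)
  then show ?thesis using assms by (elim disjE) (auto simp: snake_vertex_def)
qed

lemma snake_vertex_inj:
  assumes "p \<le> n + 2" "q \<le> n + 2" "snake_vertex n p = snake_vertex n q"
  shows "p = q"
  using snake_vertex_less_iff[OF assms(1,2)] snake_vertex_less_iff[OF assms(2,1)] assms(3)
  by (metis less_irrefl linorder_neqE_nat)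

lemma snake_vertex_surj:
  assumes "1 \<le> a" "a \<le> n + 3"
  obtains p where "p \<le> n + 2" "snake_vertex n p = a"
proof (cases "2 * a \<le> n + 3")
  case True
  then show ?thesis using assms by (intro that[of "2 * a - 1"]) (auto simp: snake_vertex_def)
next
  case False
  then show ?thesis using assms by (intro that[of "2 * (n + 3 - a)"]) (auto simp: snake_vertex_def)
qed

definition snake_chord :: "nat \<Rightarrow> nat \<Rightarrow> nat \<Rightarrow> nat set" where
  "snake_chord n p q = {snake_vertex n p, snake_vertex n q}"

lemma snake_diagonal_chord:
  assumes "1 \<le> k"
  shows "snake_diagonal n k = snake_chord n k (k + 1)"
  using assms
  by (auto simp: snake_diagonal_def snake_chord_def snake_vertex_def elim!: oddE evenE)

lemma crosses_doubletons:
  "crosses {a, b} {c, f} \<longleftrightarrow>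
     (\<exists>(x, y) \<in> {(a, b), (b, a)}. \<exists>(z, w) \<in> {(c, f), (f, c)}.
        x < z \<and> z < y \<and> y < w \<or> z < x \<and> x < w \<and> w < y)"
  unfolding crosses_def doubleton_eq_iff by fastforce

lemma crosses_commute: "crosses d e \<longleftrightarrow> crosses e d"
  unfolding crosses_def by blast

lemma not_crosses_self: "\<not> crosses {a, b} {a, b}"
  by (auto simp: crosses_doubletons)

text \<open>
  The snake diagonal from position \<open>k\<close> to position \<open>k + 1\<close> separates the earlier positions from the later
  ones.
\<close>

lemma chord_crosses_snake_iff:
  assumes "p < q" "q \<le> n + 2" "1 \<le> k" "k \<le> n"
  shows "crosses (snake_chord n p q) (snake_diagonal n k) \<longleftrightarrow> p < k \<and> k + 1 < q"
proof -
  have le: "p \<le> n + 2" "k \<le> n + 2" "k + 1 \<le> n + 2" using assms by auto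
  \<comment> \<open>Here \<open>less\<close> compares the labels of the vertices at two snake positions.\<close>
  have order: "crosses (snake_chord n p q) (snake_diagonal n k) \<longleftrightarrow>
      (\<exists>(x, y) \<in> {(p, q), (q, p)}. \<exists>(z, w) \<in> {(k, k + 1), (k + 1, k)}.
        let less = (\<lambda>u v. (odd u \<and> (even v \<or> u < v)) \<or> (even u \<and> even v \<and> v < u))
        in less x z \<and> less z y \<and> less y w \<or> less z x \<and> less x w \<and> less w y)"
    unfolding snake_diagonal_chord[OF assms(3)]
    using assms le by (simp add: snake_chord_def crosses_doubletons snake_vertex_less_iff Let_def)
  show ?thesis
    unfolding order using assms
    by (cases "even p"; cases "even q"; cases "even k"; simp; presburger)
qed

lemma snake_chord_inj:
  assumes "p < q" "q \<le> n + 2" "p' < q'" "q' \<le> n + 2" "snake_chord n p q = snake_chord n p' q'"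
  shows "p = p' \<and> q = q'"
proof -
  have "(p = p' \<and> q = q') \<or> (p = q' \<and> q = p')"
    using assms snake_vertex_inj[of p n p'] snake_vertex_inj[of q n q']
      snake_vertex_inj[of p n q'] snake_vertex_inj[of q n p']
    by (auto simp: snake_chord_def doubleton_eq_iff)
  then show ?thesis using assms by auto
qed

text \<open>
  Chords between positions at distance 2, and between the first two or last two positions, are edges
  of the polygon; from distance 3 on they are diagonals.
\<close>

lemma snake_chord_diagonal:
  assumes "p + 3 \<le> q" "q \<le> n + 2"
  shows "snake_chord n p q \<in> diagonals (n + 3)"
proof -
  obtain a b where ab: "p = 2 * a \<or> p = 2 * a + 1" "q = 2 * b \<or> q = 2 * b + 1"
    by (metis oddE evenE)
  define u where "u = min (snake_vertex n p) (snake_vertex n q)"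
  define v where "v = max (snake_vertex n p) (snake_vertex n q)"
  have "snake_chord n p q = {u, v}"
    by (auto simp: u_def v_def snake_chord_def min_def max_def)
  moreover have "1 \<le> u \<and> u + 2 \<le> v \<and> v \<le> n + 3 \<and> \<not> (u = 1 \<and> v = n + 3)"
    using ab assms by (elim disjE) (auto simp: u_def v_def snake_vertex_def min_def max_def)
  ultimately have "\<exists>u v. snake_chord n p q = {u, v} \<and> 1 \<le> u \<and> u + 2 \<le> v \<and> v \<le> n + 3 \<and>
      \<not> (u = 1 \<and> v = n + 3)" by blast
  then show ?thesis unfolding diagonals_def by blast
qed

lemma diagonal_is_snake_chord:
  assumes "d \<in> diagonals (n + 3)"
  obtains p q where "p < q" "q \<le> n + 2" "d = snake_chord n p q"
proof -
  obtain a b where ab: "d = {a, b}" "1 \<le> a" "a < b" "b \<le> n + 3"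
    using assms unfolding diagonals_def by auto
  obtain p where p: "p \<le> n + 2" "snake_vertex n p = a" using snake_vertex_surj[of a n] ab by auto
  obtain q where q: "q \<le> n + 2" "snake_vertex n q = b" using snake_vertex_surj[of b n] ab by auto
  have "p \<noteq> q" using p q ab by auto
  then show ?thesis
    using that[of p q] that[of q p] p q ab
    by (cases "p < q") (auto simp: snake_chord_def insert_commute)
qed

text \<open>
  Existence and uniqueness of the diagonal of a positive root: a chord from position \<open>p\<close> to position
  \<open>q\<close> crosses the interval of snake diagonals \<open>p + 1, ..., q - 2\<close>, which determines \<open>p\<close> and \<open>q\<close> when it is
  not empty.
\<close>

lemma diagonal_crossing_snake_interval:
  assumes "1 \<le> i" "i \<le> j" "j \<le> n"
  shows "d \<in> diagonals (n + 3) \<and> (\<forall>k\<in>{1..n}. crosses d (snake_diagonal n k) \<longleftrightarrow> i \<le> k \<and> k \<le> j)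
    \<longleftrightarrow> d = snake_chord n (i - 1) (j + 2)" (is "?L \<longleftrightarrow> ?R")
proof
  assume L: ?L
  then obtain p q where pq: "p < q" "q \<le> n + 2" "d = snake_chord n p q"
    using diagonal_is_snake_chord by blast
  have *: "(p < k \<and> k + 1 < q) \<longleftrightarrow> i \<le> k \<and> k \<le> j" if "k \<in> {1..n}" for k
    using L that chord_crosses_snake_iff[OF pq(1,2), of k] pq(3) by auto
  have "p < i" "j + 1 < q" using *[of i] *[of j] assms by auto
  moreover have "\<not> p + 1 < i"
  proof
    assume "p + 1 < i"
    then have "i - 1 \<in> {1..n}" "p < i - 1" "i - 1 + 1 < q" "\<not> i \<le> i - 1"
      using \<open>j + 1 < q\<close> assms by auto
    then show False using *[of "i - 1"] by blast
  qed
  moreover have "\<not> j + 2 < q"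
  proof
    assume "j + 2 < q"
    then have "j + 1 \<in> {1..n}" "p < j + 1" "j + 1 + 1 < q" using \<open>p < i\<close> assms pq(2) by auto
    then show False using *[of "j + 1"] by simp
  qed
  ultimately have "p = i - 1" "q = j + 2" by auto
  then show ?R using pq by simp
next
  assume R: ?R
  have "crosses d (snake_diagonal n k) \<longleftrightarrow> i \<le> k \<and> k \<le> j" if "k \<in> {1..n}" for k
    unfolding R using assms that by (subst chord_crosses_snake_iff) auto
  moreover have "d \<in> diagonals (n + 3)"
    unfolding R using assms by (intro snake_chord_diagonal) auto
  ultimately show ?L by blast
qed


section \<open>Almost positive roots and their diagonals\<close>

text \<open>
  The fundamental coweights: on \<open>sum_zero_space\<close> they are the functionals dual to the simple roots.
\<close>

definition coweight :: "(nat \<Rightarrow> 'm::finite) \<Rightarrow> nat \<Rightarrow> real ^ 'm \<Rightarrow> real" where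
  "coweight ix k x = (\<Sum>j=1..k. x $ ix j)"

lemma linear_coweight: "linear (coweight ix k)"
  by (rule linearI) (simp_all add: coweight_def sum.distrib sum_distrib_left)

definition interval_root :: "(nat \<Rightarrow> 'm::finite) \<Rightarrow> nat \<Rightarrow> nat \<Rightarrow> real ^ 'm" where
  "interval_root ix i j = (\<Sum>k=i..j. simple_root ix k)"

lemma interval_root_eq: "i \<le> j \<Longrightarrow> interval_root ix i j = std_vec ix i - std_vec ix (j + 1)"
  unfolding interval_root_def
  by (induction rule: dec_induct) (simp_all add: simple_root_def)

lemma interval_root_self [simp]: "interval_root ix i i = simple_root ix i"
  by (simp add: interval_root_def)

lemma compatible_commute: "compatible n ix \<beta> \<gamma> \<longleftrightarrow> compatible n ix \<gamma> \<beta>"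
  unfolding compatible_def using crosses_commute by blast

lemma subspace_sum_zero_space: "subspace (sum_zero_space :: (real ^ 'm::finite) set)"
  by (auto simp: subspace_def sum_zero_space_def sum.distrib simp flip: sum_distrib_left)

lemma std_vec_diff_sum_zero: "std_vec ix i - std_vec ix j \<in> sum_zero_space"
  by (simp add: sum_zero_space_def std_vec_def axis_def sum_subtractf)

text \<open>
  The basis of simple roots with signs: positive for the indices in \<open>I\<close>, negative for the others. The
  diagonals of \<open>I = {}\<close> form the snake, those of \<open>I = {i}\<close> the snake after a flip of its \<open>i\<close>-th diagonal.
\<close>

definition flipped_snake :: "nat \<Rightarrow> (nat \<Rightarrow> 'm::finite) \<Rightarrow> nat set \<Rightarrow> (real ^ 'm) set" where
  "flipped_snake n ix I = (\<lambda>k. if k \<in> I then simple_root ix k else - simple_root ix k) ` {1..n}"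

context
  fixes n :: nat and ix :: "nat \<Rightarrow> 'm::finite"
  assumes ix: "bij_betw ix {1..n+1} (UNIV :: 'm set)"
begin

lemma coweight_std_vec:
  assumes "k \<le> n + 1" "1 \<le> i" "i \<le> n + 1"
  shows "coweight ix k (std_vec ix i) = (if i \<le> k then 1 else 0)"
proof -
  have "std_vec ix i $ ix j = (if j = i then 1 else 0)" if "j \<in> {1..k}" for j
    using that assms bij_betw_imp_inj_on[OF ix]
    by (auto simp: std_vec_def axis_def inj_on_eq_iff)
  then have "coweight ix k (std_vec ix i) = (\<Sum>j=1..k. if j = i then 1 else 0)"
    by (simp add: coweight_def)
  then show ?thesis using assms by simp
qed

lemma coweight_simple_root:
  assumes "1 \<le> k" "k \<le> n" "1 \<le> i" "i \<le> n"
  shows "coweight ix k (simple_root ix i) = (if k = i then 1 else 0)"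
  using assms by (simp add: simple_root_def linear_diff[OF linear_coweight] coweight_std_vec)

text \<open>
  The coefficients with respect to the simple roots, from which the interval can be recovered.
\<close>

lemma coweight_interval_root:
  assumes "1 \<le> k" "k \<le> n" "1 \<le> i" "i \<le> j" "j \<le> n"
  shows "coweight ix k (interval_root ix i j) = (if i \<le> k \<and> k \<le> j then 1 else 0)"
  using assms
  by (simp add: interval_root_eq linear_diff[OF linear_coweight] coweight_std_vec)

lemma interval_root_eq_iff:
  assumes "1 \<le> i" "i \<le> j" "j \<le> n" "1 \<le> i'" "i' \<le> j'" "j' \<le> n"
  shows "interval_root ix i j = interval_root ix i' j' \<longleftrightarrow> i = i' \<and> j = j'"
proof
  assume "interval_root ix i j = interval_root ix i' j'"
  then have "(i \<le> k \<and> k \<le> j) = (i' \<le> k \<and> k \<le> j')" if "1 \<le> k" "k \<le> n" for k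
    using coweight_interval_root[OF that assms(1-3)] coweight_interval_root[OF that assms(4-6)]
    by (metis zero_neq_one)
  from this[of i] this[of j] this[of i'] this[of j'] show "i = i' \<and> j = j'"
    using assms by linarith
qed simp

lemma interval_root_neq_uminus:
  assumes "1 \<le> i" "i \<le> j" "j \<le> n" "1 \<le> i'" "i' \<le> j'" "j' \<le> n"
  shows "interval_root ix i j \<noteq> - interval_root ix i' j'"
proof
  assume "interval_root ix i j = - interval_root ix i' j'"
  then have "coweight ix i (interval_root ix i j) = - coweight ix i (interval_root ix i' j')"
    by (simp add: linear_neg[OF linear_coweight])
  then show False
    using assms by (simp add: coweight_interval_root split: if_splits)
qed

lemma almost_positive_root_cases:
  assumes "\<beta> \<in> almost_positive_roots n ix"
  obtains (positive) i j where "1 \<le> i" "i \<le> j" "j \<le> n" "\<beta> = interval_root ix i j"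
  | (negative) i where "1 \<le> i" "i \<le> n" "\<beta> = - simple_root ix i"
proof -
  have "(\<exists>i j. 1 \<le> i \<and> i \<le> j \<and> j \<le> n \<and> \<beta> = interval_root ix i j) \<or>
        (\<exists>i. 1 \<le> i \<and> i \<le> n \<and> \<beta> = - simple_root ix i)"
    using assms unfolding almost_positive_roots_def positive_roots_def
  proof (elim UnE CollectE exE conjE)
    fix i j assume *: "\<beta> = std_vec ix i - std_vec ix j" "1 \<le> i" "i < j" "j \<le> n + 1"
    then have "\<beta> = interval_root ix i (j - 1)" by (simp add: interval_root_eq)
    moreover have "i \<le> j - 1" "j - 1 \<le> n" using * by auto
    ultimately show ?thesis using *(2) by blast
  qed blast
  then show ?thesis using that by blast
qed

lemma interval_root_almost_positive:
  assumes "1 \<le> i" "i \<le> j" "j \<le> n"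
  shows "interval_root ix i j \<in> almost_positive_roots n ix"
proof -
  have "i < j + 1" "j + 1 \<le> n + 1" using assms by auto
  then show ?thesis
    unfolding almost_positive_roots_def positive_roots_def interval_root_eq[OF assms(2)]
    using assms(1) by blast
qed

lemma simple_root_almost_positive:
  assumes "1 \<le> i" "i \<le> n"
  shows "simple_root ix i \<in> almost_positive_roots n ix" "- simple_root ix i \<in> almost_positive_roots n ix"
  using interval_root_almost_positive[of i i] assms by (auto simp: almost_positive_roots_def)

lemma root_diagonal_interval_root:
  assumes "1 \<le> i" "i \<le> j" "j \<le> n"
  shows "root_diagonal n ix (interval_root ix i j) = snake_chord n (i - 1) (j + 2)"
  unfolding root_diagonal_def
proof (rule the_equality)
  show "(\<exists>k. 1 \<le> k \<and> k \<le> n \<and> interval_root ix i j = - simple_root ix k \<and>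
        snake_chord n (i - 1) (j + 2) = snake_diagonal n k) \<or>
    (\<exists>i' j'. 1 \<le> i' \<and> i' \<le> j' \<and> j' \<le> n \<and> interval_root ix i j = (\<Sum>k=i'..j'. simple_root ix k) \<and>
        snake_chord n (i - 1) (j + 2) \<in> diagonals (n + 3) \<and>
        (\<forall>k\<in>{1..n}. crosses (snake_chord n (i - 1) (j + 2)) (snake_diagonal n k) \<longleftrightarrow> i' \<le> k \<and> k \<le> j'))"
    using diagonal_crossing_snake_interval[OF assms, of "snake_chord n (i - 1) (j + 2)"] assms
    by (intro disjI2 exI[of _ i] exI[of _ j]) (simp add: interval_root_def)
next
  fix d
  assume "(\<exists>k. 1 \<le> k \<and> k \<le> n \<and> interval_root ix i j = - simple_root ix k \<and> d = snake_diagonal n k) \<or>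
    (\<exists>i' j'. 1 \<le> i' \<and> i' \<le> j' \<and> j' \<le> n \<and> interval_root ix i j = (\<Sum>k=i'..j'. simple_root ix k) \<and>
        d \<in> diagonals (n + 3) \<and>
        (\<forall>k\<in>{1..n}. crosses d (snake_diagonal n k) \<longleftrightarrow> i' \<le> k \<and> k \<le> j'))"
  then show "d = snake_chord n (i - 1) (j + 2)"
  proof (elim disjE exE conjE)
    fix k assume "1 \<le> k" "k \<le> n" "interval_root ix i j = - simple_root ix k"
    then show ?thesis using interval_root_neq_uminus[OF assms, of k k] by simp
  next
    fix i' j' assume *: "1 \<le> i'" "i' \<le> j'" "j' \<le> n" "interval_root ix i j = (\<Sum>k=i'..j'. simple_root ix k)"
      "d \<in> diagonals (n + 3)"
      "\<forall>k\<in>{1..n}. crosses d (snake_diagonal n k) \<longleftrightarrow> i' \<le> k \<and> k \<le> j'"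
    then have "i = i'" "j = j'"
      using interval_root_eq_iff[OF assms *(1-3)] by (auto simp: interval_root_def)
    then show ?thesis using diagonal_crossing_snake_interval[OF assms, of d] * by blast
  qed
qed

lemma root_diagonal_uminus_simple_root:
  assumes "1 \<le> i" "i \<le> n"
  shows "root_diagonal n ix (- simple_root ix i) = snake_diagonal n i"
  unfolding root_diagonal_def
proof (rule the_equality)
  fix d
  assume "(\<exists>k. 1 \<le> k \<and> k \<le> n \<and> - simple_root ix i = - simple_root ix k \<and> d = snake_diagonal n k) \<or>
    (\<exists>i' j'. 1 \<le> i' \<and> i' \<le> j' \<and> j' \<le> n \<and> - simple_root ix i = (\<Sum>k=i'..j'. simple_root ix k) \<and>
        d \<in> diagonals (n + 3) \<and>
        (\<forall>k\<in>{1..n}. crosses d (snake_diagonal n k) \<longleftrightarrow> i' \<le> k \<and> k \<le> j'))"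
  then show "d = snake_diagonal n i"
  proof (elim disjE exE conjE)
    fix k assume "1 \<le> k" "k \<le> n" "- simple_root ix i = - simple_root ix k" "d = snake_diagonal n k"
    then show ?thesis using interval_root_eq_iff[of i i k k] assms by simp
  next
    fix i' j' assume "1 \<le> i'" "i' \<le> j'" "j' \<le> n" "- simple_root ix i = (\<Sum>k=i'..j'. simple_root ix k)"
    then show ?thesis
      using interval_root_neq_uminus[of i' j' i i] assms by (simp add: interval_root_def)
  qed
qed (use assms in blast)

text \<open>
  The two end points lie at distance 1 along the snake for a negative simple root and at distance at
  least 3 for a positive root; in both cases their positions determine the root.
\<close>

lemma inj_on_root_diagonal: "inj_on (root_diagonal n ix) (almost_positive_roots n ix)"
proof (rule inj_onI)
  fix \<beta> \<gamma>
  assume "\<beta> \<in> almost_positive_roots n ix" and "\<gamma> \<in> almost_positive_roots n ix"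
    and eq: "root_diagonal n ix \<beta> = root_diagonal n ix \<gamma>"
  then show "\<beta> = \<gamma>"
  proof (elim almost_positive_root_cases)
    fix i j i' j'
    assume *: "1 \<le> i" "i \<le> j" "j \<le> n" "\<beta> = interval_root ix i j"
      "1 \<le> i'" "i' \<le> j'" "j' \<le> n" "\<gamma> = interval_root ix i' j'"
    have "i - 1 = i' - 1 \<and> j + 2 = j' + 2"
      using * eq by (intro snake_chord_inj) (auto simp: root_diagonal_interval_root)
    then have "i = i'" "j = j'" using *(1,5) by linarith+
    then show ?thesis using *(4,8) by simp
  next
    fix i j k
    assume *: "1 \<le> i" "i \<le> j" "j \<le> n" "\<beta> = interval_root ix i j" "1 \<le> k" "k \<le> n" "\<gamma> = - simple_root ix k"
    have "i - 1 = k \<and> j + 2 = k + 1"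
      using * eq by (intro snake_chord_inj)
        (auto simp: root_diagonal_interval_root root_diagonal_uminus_simple_root snake_diagonal_chord)
    then show ?thesis using *(1,2) by linarith
  next
    fix i j k
    assume *: "1 \<le> i" "i \<le> j" "j \<le> n" "\<gamma> = interval_root ix i j" "1 \<le> k" "k \<le> n" "\<beta> = - simple_root ix k"
    have "i - 1 = k \<and> j + 2 = k + 1"
      using * eq by (intro snake_chord_inj)
        (auto simp: root_diagonal_interval_root root_diagonal_uminus_simple_root snake_diagonal_chord)
    then show ?thesis using *(1,2) by linarith
  next
    fix i k
    assume *: "1 \<le> i" "i \<le> n" "\<beta> = - simple_root ix i" "1 \<le> k" "k \<le> n" "\<gamma> = - simple_root ix k"
    have "i = k \<and> i + 1 = k + 1"
      using * eq by (intro snake_chord_inj)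
        (auto simp: root_diagonal_uminus_simple_root snake_diagonal_chord)
    then show ?thesis using * by auto
  qed
qed

section \<open>The clusters around the snake\<close>

lemma compatible_interval_root_iff:
  assumes "1 \<le> i" "i \<le> j" "j \<le> n" "1 \<le> k" "k \<le> n"
  shows "compatible n ix (interval_root ix i j) (- simple_root ix k) \<longleftrightarrow> \<not> (i \<le> k \<and> k \<le> j)"
  using assms chord_crosses_snake_iff[of "i - 1" "j + 2" n k]
  by (auto simp: compatible_def root_diagonal_interval_root root_diagonal_uminus_simple_root)

lemma compatible_uminus_simple_roots:
  assumes "1 \<le> i" "i \<le> n" "1 \<le> k" "k \<le> n"
  shows "compatible n ix (- simple_root ix i) (- simple_root ix k)"
  using assms chord_crosses_snake_iff[of i "i + 1" n k]
  by (auto simp: compatible_def root_diagonal_uminus_simple_root snake_diagonal_chord[of i])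

lemma compatible_self_interval_root:
  assumes "1 \<le> i" "i \<le> j" "j \<le> n"
  shows "compatible n ix (interval_root ix i j) (interval_root ix i j)"
  using assms by (simp add: compatible_def root_diagonal_interval_root snake_chord_def not_crosses_self)

text \<open>
  Maximality: an interval root compatible with all the negative simple roots present can only involve
  indices in \<open>I\<close>, so it is \<open>\<alpha>\<^sub>i\<close>; and \<open>- \<alpha>\<^sub>i\<close> is incompatible with \<open>\<alpha>\<^sub>i\<close>.
\<close>

lemma cluster_flipped_snake:
  assumes I: "I = {} \<or> I = {i}"
  shows "cluster n ix (flipped_snake n ix I)"
proof -
  have sub: "flipped_snake n ix I \<subseteq> almost_positive_roots n ix"
    using simple_root_almost_positive by (auto simp: flipped_snake_def)
  have pm: "compatible n ix (simple_root ix k) (- simple_root ix l)"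
    if "k \<noteq> l" "1 \<le> k" "k \<le> n" "1 \<le> l" "l \<le> n" for k l
    using compatible_interval_root_iff[of k k l] that by simp
  let ?g = "\<lambda>k. if k \<in> I then simple_root ix k else - simple_root ix k"
  have "compatible n ix (?g k) (?g l)" if kl: "k \<in> {1..n}" "l \<in> {1..n}" for k l
  proof (cases "k = l")
    case True
    then show ?thesis
      using kl compatible_self_interval_root[of k k] compatible_uminus_simple_roots[of k k] by simp
  next
    case False
    then have "k \<notin> I \<or> l \<notin> I" using I by auto
    then show ?thesis
      using False kl pm[of k l] pm[of l k] compatible_uminus_simple_roots[of k l]
        compatible_commute[of n ix "- simple_root ix k"] by auto
  qed
  then have comp: "compatible_set n ix (flipped_snake n ix I)"
    using sub unfolding compatible_set_def flipped_snake_def by blast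
  moreover have "D = flipped_snake n ix I" if D: "compatible_set n ix D" "flipped_snake n ix I \<subseteq> D" for D
  proof
    show "D \<subseteq> flipped_snake n ix I"
    proof
      fix \<beta> assume \<beta>: "\<beta> \<in> D"
      then have cmp: "compatible n ix \<beta> \<gamma>" if "\<gamma> \<in> flipped_snake n ix I" for \<gamma>
        using D that by (auto simp: compatible_set_def)
      have neg: "- simple_root ix k \<in> flipped_snake n ix I" if "1 \<le> k" "k \<le> n" "k \<notin> I" for k
        using that by (auto simp: flipped_snake_def)
      have pos: "simple_root ix k \<in> flipped_snake n ix I" if "1 \<le> k" "k \<le> n" "k \<in> I" for k
        using that by (force simp: flipped_snake_def)
      have "\<beta> \<in> almost_positive_roots n ix" using D(1) \<beta> by (auto simp: compatible_set_def)
      then show "\<beta> \<in> flipped_snake n ix I"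
      proof (cases rule: almost_positive_root_cases)
        case (positive a b)
        have *: "k \<in> I" if "a \<le> k" "k \<le> b" for k
        proof (rule ccontr)
          assume "k \<notin> I"
          then have "compatible n ix (interval_root ix a b) (- simple_root ix k)"
            using that positive cmp[OF neg[of k]] by auto
          then show False using compatible_interval_root_iff[of a b k] that positive by auto
        qed
        have "a \<in> I" "b \<in> I" using *[of a] *[of b] positive by auto
        then have "b = a" using I by auto
        then show ?thesis using pos[of a] \<open>a \<in> I\<close> positive by auto
      next
        case (negative k)
        show ?thesis
        proof (cases "k \<in> I")
          case True
          then have "compatible n ix (interval_root ix k k) (- simple_root ix k)"
            using cmp[OF pos[of k]] negative compatible_commute by auto
          then show ?thesis using compatible_interval_root_iff[of k k k] negative by auto
        qed (use neg negative in auto)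
      qed
    qed
  qed (rule D(2))
  ultimately show ?thesis by (auto simp: cluster_def)
qed

text \<open>
  The \<open>k\<close>-th coweight vanishes on all elements but the \<open>k\<close>-th.
\<close>

lemma independent_flipped_snake: "independent (flipped_snake n ix I)"
  unfolding dependent_def
proof (intro notI, elim bexE)
  fix v assume v: "v \<in> flipped_snake n ix I" and span: "v \<in> span (flipped_snake n ix I - {v})"
  obtain k where k: "1 \<le> k" "k \<le> n" "v = (if k \<in> I then simple_root ix k else - simple_root ix k)"
    using v unfolding flipped_snake_def by auto
  have "coweight ix k u = 0" if u: "u \<in> flipped_snake n ix I - {v}" for u
  proof -
    obtain l where l: "l \<in> {1..n}" "u = (if l \<in> I then simple_root ix l else - simple_root ix l)"
      using u unfolding flipped_snake_def by blast
    moreover have "l \<noteq> k" using u l(2) k(3) by auto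
    ultimately show ?thesis using k
      by (simp add: linear_neg[OF linear_coweight] coweight_simple_root)
  qed
  then have "coweight ix k v = 0"
    using linear_eq_0_on_span[OF linear_coweight _ span] by blast
  then show False using k
    by (simp add: linear_neg[OF linear_coweight] coweight_simple_root split: if_splits)
qed

section \<open>Lengths and opposite pairs of roots\<close>

lemma almost_positive_roots_sum_zero: "almost_positive_roots n ix \<subseteq> sum_zero_space"
proof
  fix \<beta> assume "\<beta> \<in> almost_positive_roots n ix"
  then show "\<beta> \<in> sum_zero_space"
    using std_vec_diff_sum_zero subspace_neg[OF subspace_sum_zero_space]
    by (cases rule: almost_positive_root_cases) (auto simp: interval_root_eq simple_root_def simp del: minus_diff_eq)
qed

lemma inner_self_almost_positive_root:
  assumes "\<beta> \<in> almost_positive_roots n ix"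
  shows "\<beta> \<bullet> \<beta> = 2"
proof -
  have *: "(std_vec ix i - std_vec ix j) \<bullet> (std_vec ix i - std_vec ix j) = 2"
    if "1 \<le> i" "i < j" "j \<le> n + 1" for i j
  proof -
    have "ix i \<noteq> ix j" using that bij_betw_imp_inj_on[OF ix] by (auto simp: inj_on_eq_iff)
    then show ?thesis
      by (simp add: std_vec_def inner_diff_left inner_diff_right inner_axis_axis)
  qed
  show ?thesis using assms
    by (cases rule: almost_positive_root_cases)
      (auto simp: interval_root_eq simple_root_def * simp del: minus_diff_eq)
qed

lemma opposite_almost_positive_roots:
  assumes "\<beta> \<in> almost_positive_roots n ix" "- \<beta> \<in> almost_positive_roots n ix"
  obtains i where "1 \<le> i" "i \<le> n" "{\<beta>, - \<beta>} = {simple_root ix i, - simple_root ix i}"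
  using assms(1)
proof (cases rule: almost_positive_root_cases)
  case (positive i j)
  show ?thesis using assms(2)
  proof (cases rule: almost_positive_root_cases)
    case (positive i' j')
    then show ?thesis using interval_root_neq_uminus[of i' j' i j] \<open>\<beta> = interval_root ix i j\<close>
      \<open>1 \<le> i\<close> \<open>i \<le> j\<close> \<open>j \<le> n\<close> by auto
  next
    case (negative k)
    then show ?thesis using that[of k] by auto
  qed
next
  case (negative k)
  then show ?thesis using that[of k] by auto
qed

end

section \<open>The facets of the associahedron\<close>

context
  fixes n :: nat and ix :: "nat \<Rightarrow> 'm::finite" and P :: "(real ^ 'm) set"
  assumes ix: "bij_betw ix {1..n+1} (UNIV :: 'm set)"
    and P: "polytope P" "P \<subseteq> sum_zero_space"
    and fan: "maximal_cones (normal_fan sum_zero_space P) = {convex_cone hull C | C. cluster n ix C}"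
begin

lemma cluster_cone_is_normal_cone:
  assumes "cluster n ix C"
  obtains F where "F \<noteq> {}" "F \<subseteq> P" "normal_cone sum_zero_space P F = convex_cone hull C"
proof -
  have "convex_cone hull C \<in> maximal_cones (normal_fan sum_zero_space P)"
    unfolding fan using assms by blast
  then have "convex_cone hull C \<in> normal_fan sum_zero_space P" by (simp add: maximal_cones_def)
  then show ?thesis using that face_of_imp_subset unfolding normal_fan_def by blast
qed

lemma P_nonempty: "P \<noteq> {}"
proof -
  have "cluster n ix (flipped_snake n ix {})" by (rule cluster_flipped_snake[OF ix]) simp
  then obtain F where "F \<noteq> {}" "F \<subseteq> P" by (rule cluster_cone_is_normal_cone)
  then show ?thesis by blast
qed

lemma directions_P: "directions P = sum_zero_space"
proof -
  have "cluster n ix (flipped_snake n ix {})" by (rule cluster_flipped_snake[OF ix]) simp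
  then obtain F where F: "F \<subseteq> P"
      "normal_cone sum_zero_space P F = convex_cone hull flipped_snake n ix {}"
    by (rule cluster_cone_is_normal_cone)
  show ?thesis
    by (rule directions_eq_if_pointed_normal_cone[OF subspace_sum_zero_space P(2) F(1)
          independent_flipped_snake[OF ix] F(2)])
qed

lemma almost_positive_root_direction:
  assumes "\<beta> \<in> almost_positive_roots n ix"
  shows "\<beta> \<in> directions P" "\<beta> \<noteq> 0"
  using assms almost_positive_roots_sum_zero[OF ix] inner_self_almost_positive_root[OF ix assms]
  by (auto simp: directions_P)

lemma flipped_snake_facet:
  assumes "I = {} \<or> I = {i}" "\<beta> \<in> flipped_snake n ix I"
  shows "face_in_direction P \<beta> facet_of P"
proof -
  have cl: "cluster n ix (flipped_snake n ix I)" using cluster_flipped_snake[OF ix assms(1)] .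
  then obtain F where F: "F \<noteq> {}" "F \<subseteq> P"
      "normal_cone sum_zero_space P F = convex_cone hull flipped_snake n ix I"
    by (rule cluster_cone_is_normal_cone)
  have "flipped_snake n ix I \<subseteq> directions P"
    using cl almost_positive_root_direction by (auto simp: cluster_def compatible_set_def)
  then show ?thesis
    by (rule simplicial_cone_generators_are_facet_normals[OF P(1) _ directions_P
          independent_flipped_snake[OF ix] F assms(2)])
qed

lemma simple_root_facets:
  assumes "i \<in> {1..n}"
  shows "face_in_direction P (simple_root ix i) facet_of P"
    and "face_in_direction P (- simple_root ix i) facet_of P"
proof -
  have "simple_root ix i \<in> flipped_snake n ix {i}" "- simple_root ix i \<in> flipped_snake n ix {}"
    using assms unfolding flipped_snake_def by (auto intro: image_eqI[of _ _ i])
  then show "face_in_direction P (simple_root ix i) facet_of P"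
    and "face_in_direction P (- simple_root ix i) facet_of P"
    using flipped_snake_facet[of "{i}" i] flipped_snake_facet[of "{}" i] by simp_all
qed

lemma facet_has_root_normal:
  assumes "G facet_of P"
  obtains \<beta> where "\<beta> \<in> almost_positive_roots n ix" "G = face_in_direction P \<beta>"
proof -
  obtain w where w: "w \<in> directions P" "G = face_in_direction P w"
    by (rule facet_normal_exists[OF P(1) assms])
  obtain K where "K \<in> maximal_cones (normal_fan sum_zero_space P)" and wK: "w \<in> K"
    by (rule in_maximal_normal_cone[OF P(1) P_nonempty w(1)[unfolded directions_P]])
  then obtain C where C: "cluster n ix C" "K = convex_cone hull C" unfolding fan by blast
  obtain F where F: "F \<noteq> {}" "F \<subseteq> P" "normal_cone sum_zero_space P F = convex_cone hull C"
    using cluster_cone_is_normal_cone[OF C(1)] .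
  have roots: "C \<subseteq> almost_positive_roots n ix" using C(1) by (simp add: cluster_def compatible_set_def)
  then have nonzero: "C \<subseteq> directions P - {0}" using almost_positive_root_direction by blast
  obtain \<beta> where "\<beta> \<in> C" "face_in_direction P w = face_in_direction P \<beta>"
    by (rule facet_normal_among_generators[OF P(1) nonzero F wK[unfolded C(2)] assms[unfolded w(2)]])
  then show ?thesis using that roots w(2) by blast
qed

text \<open>
  Collinear roots agree up to sign because all roots have the same length.
\<close>

lemma same_directions_imp_same_or_opposite:
  assumes roots: "\<beta> \<in> almost_positive_roots n ix" "\<gamma> \<in> almost_positive_roots n ix"
    and facets: "face_in_direction P \<beta> facet_of P" "face_in_direction P \<gamma> facet_of P"
    and dirs: "directions (face_in_direction P \<beta>) = directions (face_in_direction P \<gamma>)"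
  shows "\<gamma> = \<beta> \<or> \<gamma> = - \<beta>"
proof -
  obtain c where c: "\<gamma> = c *\<^sub>R \<beta>"
    by (rule facets_same_directions_imp_collinear_normals[OF
          facets(1) almost_positive_root_direction(1)[OF roots(1)]
          facets(2) almost_positive_root_direction(1)[OF roots(2)] dirs])
  \<comment> \<open>Both sides are the squared length of \<open>\<gamma>\<close>.\<close>
  have "c * c * 2 = 2"
    using inner_self_almost_positive_root[OF ix roots(1)] inner_self_almost_positive_root[OF ix roots(2)] c
    by simp
  then have "c = 1 \<or> c = - 1" by (simp add: square_eq_1_iff)
  then show ?thesis using c by auto
qed

lemma face_in_direction_root_inj:
  assumes "\<beta> \<in> almost_positive_roots n ix" "\<gamma> \<in> almost_positive_roots n ix"
    and "face_in_direction P \<beta> facet_of P" "face_in_direction P \<beta> = face_in_direction P \<gamma>"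
  shows "\<beta> = \<gamma>"
proof -
  have "face_in_direction P \<beta> \<noteq> face_in_direction P (- \<beta>)"
    using assms(3) almost_positive_root_direction[OF assms(1)]
    by (intro face_in_direction_uminus_neq) (auto simp: facet_of_def)
  then show ?thesis
    using same_directions_imp_same_or_opposite[OF assms(1,2)] assms(3,4) by metis
qed

lemma parallel_facets_iff:
  "parallel_facets P F G \<longleftrightarrow>
     (\<exists>i\<in>{1..n}. {F, G} = {face_in_direction P (simple_root ix i), face_in_direction P (- simple_root ix i)})"
proof
  assume "parallel_facets P F G"
  then have FG: "F facet_of P" "G facet_of P" "F \<noteq> G" "directions F = directions G"
    by (auto simp: parallel_facets_def directions_def)
  obtain \<beta> where \<beta>: "\<beta> \<in> almost_positive_roots n ix" "F = face_in_direction P \<beta>"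
    by (rule facet_has_root_normal[OF FG(1)])
  obtain \<gamma> where \<gamma>: "\<gamma> \<in> almost_positive_roots n ix" "G = face_in_direction P \<gamma>"
    by (rule facet_has_root_normal[OF FG(2)])
  have "\<gamma> = \<beta> \<or> \<gamma> = - \<beta>"
    using FG(1,2,4) unfolding \<beta>(2) \<gamma>(2)
    by (rule same_directions_imp_same_or_opposite[OF \<beta>(1) \<gamma>(1)])
  then have "\<gamma> = - \<beta>" using FG(3) \<beta>(2) \<gamma>(2) by blast
  then have "- \<beta> \<in> almost_positive_roots n ix" using \<gamma>(1) by simp
  then obtain i where i: "1 \<le> i" "i \<le> n" "{\<beta>, - \<beta>} = {simple_root ix i, - simple_root ix i}"
    by (rule opposite_almost_positive_roots[OF ix \<beta>(1)])
  have "{F, G} = face_in_direction P ` {\<beta>, - \<beta>}" using \<beta> \<gamma> \<open>\<gamma> = - \<beta>\<close> by simp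
  then show "\<exists>i\<in>{1..n}. {F, G} = {face_in_direction P (simple_root ix i), face_in_direction P (- simple_root ix i)}"
    unfolding i(3) using i(1,2) by (intro bexI[of _ i]) simp_all
next
  assume "\<exists>i\<in>{1..n}. {F, G} = {face_in_direction P (simple_root ix i), face_in_direction P (- simple_root ix i)}"
  then obtain i where i: "i \<in> {1..n}"
    and FG: "{F, G} = {face_in_direction P (simple_root ix i), face_in_direction P (- simple_root ix i)}"
    by blast
  let ?a = "simple_root ix i"
  have a: "?a \<in> directions P" "- ?a \<in> directions P" "?a \<noteq> 0"
    using i almost_positive_root_direction[OF simple_root_almost_positive(1)[OF ix]]
      almost_positive_root_direction(1)[OF simple_root_almost_positive(2)[OF ix]] by simp_all
  note facets = simple_root_facets[OF i]
  have "face_in_direction P ?a \<noteq> face_in_direction P (- ?a)"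
    using facets(1) a by (intro face_in_direction_uminus_neq) (auto simp: facet_of_def)
  moreover have "directions (face_in_direction P ?a) = directions (face_in_direction P (- ?a))"
    using directions_facet[OF facets(1) a(1)] directions_facet[OF facets(2) a(2)] by simp
  ultimately have "parallel_facets P (face_in_direction P ?a) (face_in_direction P (- ?a))"
    "parallel_facets P (face_in_direction P (- ?a)) (face_in_direction P ?a)"
    using facets by (auto simp: parallel_facets_def directions_def)
  then show "parallel_facets P F G"
    using FG unfolding doubleton_eq_iff by blast
qed

lemma bij_betw_parallel_facet_pairs:
  "bij_betw (\<lambda>i. {face_in_direction P (simple_root ix i), face_in_direction P (- simple_root ix i)})
     {1..n} (parallel_facet_pairs P)"
  unfolding bij_betw_def
proof
  show "inj_on (\<lambda>i. {face_in_direction P (simple_root ix i), face_in_direction P (- simple_root ix i)}) {1..n}"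
  proof (rule inj_onI)
    fix i j assume i: "i \<in> {1..n}" and j: "j \<in> {1..n}"
      and eq: "{face_in_direction P (simple_root ix i), face_in_direction P (- simple_root ix i)} =
               {face_in_direction P (simple_root ix j), face_in_direction P (- simple_root ix j)}"
    note roots = simple_root_almost_positive[OF ix]
    have "face_in_direction P (simple_root ix i) = face_in_direction P (simple_root ix j) \<or>
          face_in_direction P (simple_root ix i) = face_in_direction P (- simple_root ix j)"
      using eq by blast
    then have "simple_root ix i = simple_root ix j \<or> simple_root ix i = - simple_root ix j"
      using face_in_direction_root_inj[OF _ _ simple_root_facets(1)[OF i]] roots i j by auto
    then show "i = j"
      using interval_root_eq_iff[OF ix, of i i j j] interval_root_neq_uminus[OF ix, of i i j j] i j
      by auto
  qed
  show "(\<lambda>i. {face_in_direction P (simple_root ix i), face_in_direction P (- simple_root ix i)}) ` {1..n} =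
        parallel_facet_pairs P"
    unfolding parallel_facet_pairs_def parallel_facets_iff by blast
qed

end

section \<open>Parallel facets\<close>

theorem theorem2p12:
  fixes n :: nat and ix :: "nat \<Rightarrow> 'm::finite" and P :: "(real ^ 'm) set"
  assumes "n \<ge> 1"
    and "bij_betw ix {1..n+1} (UNIV :: 'm set)"
    and "polytope P" and "P \<subseteq> sum_zero_space"
    and "maximal_cones (normal_fan sum_zero_space P) = {convex_cone hull C | C. cluster n ix C}"
  shows "card (parallel_facet_pairs P) = n \<and>
         bij_betw (\<lambda>i. {face_in_direction P (simple_root ix i),
                        face_in_direction P (- simple_root ix i)})
           {1..n} (parallel_facet_pairs P) \<and>
         bij_betw (\<lambda>i. {facet_of_diagonal n ix P (root_diagonal n ix (simple_root ix i)),
                        facet_of_diagonal n ix P (root_diagonal n ix (- simple_root ix i))})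
           {1..n} (parallel_facet_pairs P)"
proof -
  note bij = bij_betw_parallel_facet_pairs[OF assms(2-5)]
  \<comment> \<open>The diagonal determines its root, so passing to diagonals and back changes nothing.\<close>
  have diag: "facet_of_diagonal n ix P (root_diagonal n ix \<beta>) = face_in_direction P \<beta>"
    if "\<beta> \<in> almost_positive_roots n ix" for \<beta>
    using that by (simp add: facet_of_diagonal_def inv_into_f_f[OF inj_on_root_diagonal[OF assms(2)]])
  have "bij_betw (\<lambda>i. {facet_of_diagonal n ix P (root_diagonal n ix (simple_root ix i)),
                       facet_of_diagonal n ix P (root_diagonal n ix (- simple_root ix i))})
          {1..n} (parallel_facet_pairs P) \<longleftrightarrow>
        bij_betw (\<lambda>i. {face_in_direction P (simple_root ix i),
                       face_in_direction P (- simple_root ix i)})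
          {1..n} (parallel_facet_pairs P)"
    by (intro bij_betw_cong) (auto simp: diag simple_root_almost_positive[OF assms(2)])
  then show ?thesis using bij bij_betw_same_card[OF bij] by simp
qed

end
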